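(* Let $D\in\mathbb N$ with $D\ge3$ and suppose all degrees equal $D$, i.e. $n_k=0$ and $p_k=0$ for $k\ne D$ and $n_D=n$, $p_D=1$. Fix $q_D\in(0,1]$, and let $E_D^{n,\varepsilon}$ denote the event that the configuration model $G([n],\boldsymbol d(n))$ has a connected component whose number of vertices $N_D$ lies in $[n(q_D-\varepsilon),n(q_D+\varepsilon)]$. Then $$\lim\star_{\varepsilon\to0}\ \lim\star_{n\to\infty}\frac1n\log P\{E_D^{n,\varepsilon}\}=-\Big(1-\frac D2\Big)\big(q_D\log q_D+(1-q_D)\log(1-q_D)\big),$$ where each $\lim\star$ stands for either $\limsup$ or $\liminf$ (the equality holds for every choice).
   Context: For each $n$ (with $nD$ even, so that the degree sequence has even sum), $\boldsymbol d(n)=(D,\dots,D)$ and $G([n],\boldsymbol d(n))$ is the random multigraph on $[n]=\{1,\dots,n\}$ obtained by attaching $D$ half-edges to each vertex and taking a uniformly random perfect matching of all $nD$ half-edges, each matched pair forming an edge (self-loops and multiple edges allowed). Limits in $n$ are along $n$ with $nD$ even. Here $n_k$ is the number of vertices of degree $k$ and $p_k=\lim_n n_k/n$. Convention: $0\log0=0$. *)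

theory Defs
  imports "HOL-Probability.Probability" "HOL-Library.Multiset" "HOL-Library.Disjoint_Sets"
begin

text \<open>A half-edge is a pair of the vertex it is attached to and an index below the degree of
  that vertex.\<close>

definition half_edges :: "nat \<Rightarrow> (nat \<Rightarrow> nat) \<Rightarrow> (nat \<times> nat) set" where
  "half_edges n d = (SIGMA v:{1..n}. {..<d v})"

definition perfect_matchings :: "'a set \<Rightarrow> 'a set set set" where
  "perfect_matchings H = {M. partition_on H M \<and> (\<forall>e\<in>M. card e = 2)}"

text \<open>A multigraph is given by its multiset of edges, where an edge is its set of endpoints:
  \<open>{u, v}\<close> with \<open>u \<noteq> v\<close> for an ordinary edge and the singleton \<open>{v}\<close> for a self-loop at \<open>v\<close>.\<close>

type_synonym 'v multigraph = "'v set multiset"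

definition multigraph_of_matching :: "('v \<times> 'b) set set \<Rightarrow> 'v multigraph" where
  "multigraph_of_matching M = image_mset (\<lambda>e. fst ` e) (mset_set M)"

text \<open>The set of matchings is always finite; it is nonempty, so that the uniform distribution is
  meaningful, exactly when the sum of the degrees is even.\<close>

definition configuration_model :: "nat \<Rightarrow> (nat \<Rightarrow> nat) \<Rightarrow> nat multigraph pmf" where
  "configuration_model n d =
     map_pmf multigraph_of_matching (pmf_of_set (perfect_matchings (half_edges n d)))"

definition adjacency :: "'v multigraph \<Rightarrow> ('v \<times> 'v) set" where
  "adjacency G = {(u, v). {u, v} \<in># G}"

definition connected_components :: "'v set \<Rightarrow> 'v multigraph \<Rightarrow> 'v set set" where
  "connected_components V G = V // {(u, v). u \<in> V \<and> v \<in> V \<and> (u, v) \<in> (adjacency G)\<^sup>*}"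

definition component_size_event :: "nat \<Rightarrow> real \<Rightarrow> real \<Rightarrow> nat multigraph set" where
  "component_size_event n q \<epsilon> =
     {G. \<exists>C\<in>connected_components {1..n} G.
           real (card C) \<in> {real n * (q - \<epsilon>) .. real n * (q + \<epsilon>)}}"

text \<open>The natural logarithm of a probability, with \<open>log 0 = -\<infinity>\<close> (whereas \<open>ln 0 = 0\<close> on the reals).\<close>

definition log_prob :: "real \<Rightarrow> ereal" where
  "log_prob p = (if p = 0 then -\<infinity> else ereal (ln p))"

end

theory Submission
  imports Defs "HOL-Real_Asymp.Real_Asymp"
begin

text \<open>Write \<open>h(x) = - x log x - (1 - x) log (1 - x)\<close>. A vertex set
\<open>A\<close> of size \<open>k\<close> is closed if no edge leaves it. For a closed set a
matching is a matching of the half-edges at \<open>A\<close> together with one of the remaining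
half-edges, so the expected number of closed sets of size \<open>k\<close> is \<open>T(n,k) = (n
choose k) m(kD) m((n-k)D) / m(nD)\<close>, where \<open>m(2s) = (2s)! / (2^s s!)\<close> counts the
perfect matchings of \<open>2s\<close> points. Cancelling the powers of two gives \<open>T(n,k) = (n
choose k) (N choose s) / (2N choose 2s)\<close> with \<open>2N = nD\<close>, \<open>2s = kD\<close>,
and Stirling's formula up to polynomial factors gives \<open>log T(n,k) = n h(k/n) (1 + D/2 - D) +
O(log n) = n (1 - D/2) h(k/n) + O(log n)\<close>. This rate at \<open>k = qn\<close> is the limit
that is claimed.

Upper bound: a component is a closed set, so the probability of the event is at most the sum of
\<open>T(n,k)\<close> over the at most \<open>n + 1\<close> admissible sizes \<open>k\<close>, and
\<open>h\<close> is continuous on \<open>[0,1]\<close>.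

Lower bound: it suffices to make the component of one fixed vertex have size exactly
\<open>k\<close>, for a single \<open>k\<close> close to \<open>qn\<close> with \<open>kD\<close>
even. The events that this component equals \<open>A\<close> are disjoint for different
\<open>A\<close>, so their probabilities add up, to \<open>(k/n) T(n,k)\<close> times the
probability that the configuration model on \<open>k\<close> vertices is connected. That last
probability is at least \<open>1/2\<close> for \<open>k \<ge> 14\<close>: a disconnected graph has a
closed set of some size \<open>j\<close> between \<open>1\<close> and \<open>k/2\<close>, and for
\<open>D \<ge> 3\<close> the numbers \<open>T(k,j)\<close> are so small that they sum to at most
\<open>1/2\<close>. The reason is Vandermonde's inequality \<open>(a choose i) (b choose j) \<le> (a
+ b choose i + j)\<close>: for \<open>2N = kD\<close> and \<open>2s = jD\<close>, applied with
\<open>N + N\<close> it bounds \<open>T(k,j)\<close> by \<open>(k choose j) / (N choose s)\<close>,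
and applied with \<open>N = k + k(D - 2)/2\<close> it bounds this by the inverse of the binomial
coefficient of \<open>k(D - 2)/2\<close> over \<open>j(D - 2)/2\<close>.

The lemmas that carry the argument are \<open>splitting_matchings_bij\<close>,
\<open>expected_closed_sets_le\<close>, \<open>card_matchings_with_component_ge\<close>,
\<open>ln_expected_closed_sets\<close> and \<open>component_size_rate_bounds\<close>.\<close>

section \<open>Perfect matchings\<close>

definition splits_at :: "'a set \<Rightarrow> 'a set set \<Rightarrow> bool" where
  "splits_at S M \<longleftrightarrow> (\<forall>e\<in>M. e \<subseteq> S \<or> e \<inter> S = {})"

lemma perfect_matchings_iff:
  "M \<in> perfect_matchings H \<longleftrightarrow> \<Union>M = H \<and> disjoint M \<and> (\<forall>e\<in>M. card e = 2)"
  by (auto simp: perfect_matchings_def partition_on_def)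

lemma finite_perfect_matchings: "finite H \<Longrightarrow> finite (perfect_matchings H)"
  by (rule finite_subset[of _ "Pow (Pow H)"]) (auto simp: perfect_matchings_iff)

lemma finite_matching: "finite H \<Longrightarrow> M \<in> perfect_matchings H \<Longrightarrow> finite M"
  by (rule finite_subset[of _ "Pow H"]) (auto simp: perfect_matchings_iff)

text \<open>A block of a split matching that meets \<open>S\<close> lies in \<open>S\<close>, so
restricting to the blocks inside \<open>S\<close> and to those outside \<open>S\<close> inverts the
union. This one bijection serves both the recursion for the number of matchings, with
\<open>S\<close> a pair, and the count of the matchings under which a vertex set is closed.\<close>

lemma splitting_matchings_bij:
  assumes "S \<subseteq> H"
  shows "bij_betw (\<lambda>(M, N). M \<union> N) (perfect_matchings S \<times> perfect_matchings (H - S))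
           {M \<in> perfect_matchings H. splits_at S M}"
proof (rule bij_betw_byWitness[where f' = "\<lambda>M. ({e \<in> M. e \<subseteq> S}, {e \<in> M. e \<inter> S = {}})"])
  have ne: "e \<noteq> {}" if "card e = 2" for e :: "'a set" using that by auto
  show "\<forall>p\<in>perfect_matchings S \<times> perfect_matchings (H - S).
      (\<lambda>M. ({e \<in> M. e \<subseteq> S}, {e \<in> M. e \<inter> S = {}})) ((\<lambda>(M, N). M \<union> N) p) = p"
  proof (intro ballI, clarify)
    fix M N assume M: "M \<in> perfect_matchings S" and N: "N \<in> perfect_matchings (H - S)"
    have "e \<subseteq> S \<and> e \<inter> S \<noteq> {}" if "e \<in> M" for e
      using M that ne[of e] by (auto simp: perfect_matchings_iff)
    moreover have "e \<inter> S = {} \<and> \<not> e \<subseteq> S" if "e \<in> N" for e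
      using N that ne[of e] by (auto simp: perfect_matchings_iff)
    ultimately show "{e \<in> M \<union> N. e \<subseteq> S} = M \<and> {e \<in> M \<union> N. e \<inter> S = {}} = N"
      by blast
  qed
  show "\<forall>M\<in>{M \<in> perfect_matchings H. splits_at S M}.
      (\<lambda>(M, N). M \<union> N) ({e \<in> M. e \<subseteq> S}, {e \<in> M. e \<inter> S = {}}) = M"
    by (auto simp: splits_at_def)
  show "(\<lambda>(M, N). M \<union> N) ` (perfect_matchings S \<times> perfect_matchings (H - S))
      \<subseteq> {M \<in> perfect_matchings H. splits_at S M}"
  proof clarify
    fix M N assume M: "M \<in> perfect_matchings S" and N: "N \<in> perfect_matchings (H - S)"
    have "disjoint (M \<union> N)"
      using M N by (intro disjoint_union) (auto simp: perfect_matchings_iff)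
    then show "M \<union> N \<in> perfect_matchings H \<and> splits_at S (M \<union> N)"
      using M N assms by (auto simp: perfect_matchings_iff splits_at_def)
  qed
  show "(\<lambda>M. ({e \<in> M. e \<subseteq> S}, {e \<in> M. e \<inter> S = {}})) ` {M \<in> perfect_matchings H. splits_at S M}
      \<subseteq> perfect_matchings S \<times> perfect_matchings (H - S)"
  proof clarify
    fix M assume M: "M \<in> perfect_matchings H" and r: "splits_at S M"
    have "disjoint {e \<in> M. e \<subseteq> S}" "disjoint {e \<in> M. e \<inter> S = {}}"
      using M by (auto simp: perfect_matchings_iff intro: pairwise_subset)
    moreover have "\<Union>{e \<in> M. e \<subseteq> S} = S" "\<Union>{e \<in> M. e \<inter> S = {}} = H - S"
    proof -
      have "\<exists>e\<in>M. x \<in> e \<and> (e \<subseteq> S \<or> e \<inter> S = {})" if "x \<in> H" for x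
        using M r that unfolding perfect_matchings_iff splits_at_def by (metis UnionE)
      moreover have "\<Union>M = H" using M by (simp add: perfect_matchings_iff)
      ultimately show "\<Union>{e \<in> M. e \<subseteq> S} = S" "\<Union>{e \<in> M. e \<inter> S = {}} = H - S"
        using assms by blast+
    qed
    ultimately show "{e \<in> M. e \<subseteq> S} \<in> perfect_matchings S
        \<and> {e \<in> M. e \<inter> S = {}} \<in> perfect_matchings (H - S)"
      using M by (auto simp: perfect_matchings_iff)
  qed
qed

lemma perfect_matchings_pair:
  assumes "x \<noteq> y"
  shows "perfect_matchings {x, y} = {{{x, y}}}"
proof
  show "perfect_matchings {x, y} \<subseteq> {{{x, y}}}"
  proof
    fix M assume M: "M \<in> perfect_matchings {x, y}"
    have "e = {x, y}" if "e \<in> M" for e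
      using M that assms by (intro card_subset_eq) (auto simp: perfect_matchings_iff)
    moreover have "M \<noteq> {}" using M by (auto simp: perfect_matchings_iff)
    ultimately show "M \<in> {{{x, y}}}" by blast
  qed
  show "{{{x, y}}} \<subseteq> perfect_matchings {x, y}"
    using assms by (auto simp: perfect_matchings_iff)
qed

text \<open>The double factorial \<open>(m - 1)!!\<close> for even \<open>m\<close>, and
\<open>0\<close> for odd \<open>m\<close>.\<close>

fun matching_number :: "nat \<Rightarrow> nat" where
  "matching_number 0 = 1"
| "matching_number (Suc 0) = 0"
| "matching_number (Suc (Suc m)) = Suc m * matching_number m"

text \<open>A fixed point \<open>x\<close> is matched with exactly one \<open>y\<close>, and the
matchings that contain the pair \<open>{x, y}\<close> are those that split at it.\<close>

lemma card_perfect_matchings: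
  "finite H \<Longrightarrow> card (perfect_matchings H) = matching_number (card H)"
proof (induction "card H" arbitrary: H rule: matching_number.induct)
  case 1
  then have H: "H = {}" by simp
  have "M = {}" if M: "M \<in> perfect_matchings {}" for M :: "'a set set"
  proof (rule ccontr)
    assume "M \<noteq> {}"
    then obtain e where "e \<in> M" by blast
    then have "e = {}" "card e = 2" using M by (auto simp: perfect_matchings_iff)
    then show False by simp
  qed
  moreover have "{} \<in> perfect_matchings ({} :: 'a set)" by (simp add: perfect_matchings_iff)
  ultimately have "perfect_matchings H = {{}}" using H by blast
  then show ?case using 1 by simp
next
  case 2
  then obtain x where x: "H = {x}" by (metis One_nat_def card_1_singletonE)
  have "M \<notin> perfect_matchings H" for M
  proof
    assume M: "M \<in> perfect_matchings H"
    then obtain e where e: "e \<in> M" "x \<in> e" using x by (auto simp: perfect_matchings_iff)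
    then have "e \<subseteq> {x}" using M x by (auto simp: perfect_matchings_iff)
    then have "card e \<le> 1" using card_mono[of "{x}" e] by simp
    then show False using M e by (auto simp: perfect_matchings_iff)
  qed
  then have "perfect_matchings H = {}" by blast
  then show ?case using x by simp
next
  case (3 m)
  then obtain x where x: "x \<in> H" by (metis card.empty ex_in_conv nat.distinct(1))
  let ?R = "\<lambda>y. {M \<in> perfect_matchings H. splits_at {x, y} M}"
  have cov: "perfect_matchings H = (\<Union>y\<in>H - {x}. ?R y)"
  proof (intro equalityI subsetI)
    fix M assume M: "M \<in> perfect_matchings H"
    then obtain e where e: "e \<in> M" "x \<in> e" using x by (auto simp: perfect_matchings_iff)
    moreover have "card e = 2" using M e by (simp add: perfect_matchings_iff)
    then obtain u v where "e = {u, v}" "u \<noteq> v" by (meson card_2_iff)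
    ultimately obtain y where y: "e = {x, y}" "y \<noteq> x" by fastforce
    have "y \<in> H" using M e y by (auto simp: perfect_matchings_iff)
    moreover have "splits_at {x, y} M"
      using M e y unfolding splits_at_def perfect_matchings_iff
      by (metis disjointD subset_refl)
    ultimately show "M \<in> (\<Union>y\<in>H - {x}. ?R y)" using M y by blast
  qed auto
  have disj: "?R y \<inter> ?R z = {}" if yz: "y \<in> H - {x}" "z \<in> H - {x}" "y \<noteq> z" for y z
  proof -
    have False if M: "M \<in> ?R y" "M \<in> ?R z" for M
    proof -
      obtain e where e: "e \<in> M" "x \<in> e" using x M by (auto simp: perfect_matchings_iff)
      then have "e \<subseteq> {x, y}" "e \<subseteq> {x, z}" using M by (auto simp: splits_at_def)
      then have "e \<subseteq> {x}" using yz by auto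
      then have "card e \<le> 1" using card_mono[of "{x}" e] by simp
      then show False using M e by (auto simp: perfect_matchings_iff)
    qed
    then show ?thesis by blast
  qed
  have R: "card (?R y) = matching_number m" if y: "y \<in> H - {x}" for y
  proof -
    have "card (?R y) = card (perfect_matchings {x, y} \<times> perfect_matchings (H - {x, y}))"
      using splitting_matchings_bij[of "{x, y}" H] x y by (auto dest!: bij_betw_same_card)
    also have "\<dots> = card (perfect_matchings (H - {x, y}))"
      using y perfect_matchings_pair[of x y] by (auto simp: card_cartesian_product)
    also have "\<dots> = matching_number m"
    proof -
      have "card (H - {x, y}) = card H - card {x, y}"
        using x y by (intro card_Diff_subset) auto
      also have "card {x, y} = 2" using y by auto
      also have "card H - 2 = m" using 3(2) by simp
      finally show ?thesis using 3(1)[of "H - {x, y}"] 3(3) by simp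
    qed
    finally show ?thesis .
  qed
  have "card (perfect_matchings H) = card (\<Union>y\<in>H - {x}. ?R y)"
    by (rule arg_cong[OF cov])
  also have "\<dots> = (\<Sum>y\<in>H - {x}. card (?R y))"
    using 3(3) disj finite_perfect_matchings[of H] by (intro card_UN_disjoint) auto
  also have "\<dots> = Suc m * matching_number m"
    using R x 3(3) by (simp add: 3(2)[symmetric])
  finally show ?case by (simp only: 3(2)[symmetric] matching_number.simps(3))
qed

lemma card_splitting_matchings:
  assumes "finite H" "S \<subseteq> H"
  shows "card {M \<in> perfect_matchings H. splits_at S M}
    = matching_number (card S) * matching_number (card H - card S)"
proof -
  have "card {M \<in> perfect_matchings H. splits_at S M}
      = card (perfect_matchings S \<times> perfect_matchings (H - S))"
    using splitting_matchings_bij[OF assms(2)] by (auto dest!: bij_betw_same_card)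
  then show ?thesis
    using assms by (simp add: card_cartesian_product card_perfect_matchings card_Diff_subset
        finite_subset)
qed

lemma splits_at_Int: "splits_at S M \<Longrightarrow> splits_at T M \<Longrightarrow> splits_at (S \<inter> T) M"
  unfolding splits_at_def by (metis Int_subset_iff inf.assoc inf.commute inf_bot_left)

lemma splits_at_subset: "splits_at S M \<Longrightarrow> N \<subseteq> M \<Longrightarrow> splits_at S N"
  unfolding splits_at_def by (meson subsetD)

section \<open>Closed vertex sets and components\<close>

definition stubs :: "nat \<Rightarrow> 'v set \<Rightarrow> ('v \<times> nat) set" where
  "stubs D A = A \<times> {..<D}"

lemma half_edges_const: "half_edges n (\<lambda>_. D) = stubs D {1..n}"
  by (simp add: half_edges_def stubs_def)

lemma stubs_Int: "stubs D (A \<inter> B) = stubs D A \<inter> stubs D B"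
  by (auto simp: stubs_def)

lemma stubs_mono: "A \<subseteq> B \<Longrightarrow> stubs D A \<subseteq> stubs D B"
  by (auto simp: stubs_def)

lemma card_stubs: "card (stubs D A) = card A * D"
  by (simp add: stubs_def card_cartesian_product)

lemma finite_stubs: "finite A \<Longrightarrow> finite (stubs D A)"
  by (simp add: stubs_def)

text \<open>Connectedness of the graph on \<open>A\<close>, in terms of closed sets instead of
paths: no proper nonempty part of \<open>A\<close> is closed. This form makes the counting arguments
purely set-theoretic.\<close>

definition connects :: "nat \<Rightarrow> 'v set \<Rightarrow> ('v \<times> nat) set set \<Rightarrow> bool" where
  "connects D A M \<longleftrightarrow> (\<forall>B\<subseteq>A. splits_at (stubs D B) M \<longrightarrow> B = {} \<or> B = A)"

lemma connects_superset: "connects D A M \<Longrightarrow> M \<subseteq> N \<Longrightarrow> connects D A N"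
  unfolding connects_def by (blast intro: splits_at_subset)

lemma adjacency_matching:
  assumes "finite M"
  shows "adjacency (multigraph_of_matching M) = {(u, v). \<exists>e\<in>M. fst ` e = {u, v}}"
  using assms by (auto simp: adjacency_def multigraph_of_matching_def)

text \<open>\<open>stubs D A\<close> contains all or none of the half-edges at a vertex, so a block
is cut by it exactly if the endpoints of the corresponding edge are separated by
\<open>A\<close>.\<close>

lemma splits_at_stubs_iff:
  assumes "M \<in> perfect_matchings (stubs D V)" "finite M"
  shows "splits_at (stubs D A) M \<longleftrightarrow>
    (\<forall>(u, v)\<in>adjacency (multigraph_of_matching M). u \<in> A \<longleftrightarrow> v \<in> A)"
proof -
  have sub: "e \<subseteq> stubs D V" if "e \<in> M" for e
    using assms that by (auto simp: perfect_matchings_iff)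
  have *: "(e \<subseteq> stubs D A \<or> e \<inter> stubs D A = {}) \<longleftrightarrow>
      (\<forall>u v. fst ` e = {u, v} \<longrightarrow> (u \<in> A \<longleftrightarrow> v \<in> A))" if e: "e \<in> M" for e
  proof -
    have "card e = 2" using assms e by (auto simp: perfect_matchings_iff)
    then obtain u i v j where e': "e = {(u, i), (v, j)}"
      by (metis card_2_iff surj_pair)
    have "i < D" "j < D" using sub[OF e] e' by (auto simp: stubs_def)
    then show ?thesis unfolding e' by (auto simp: stubs_def doubleton_eq_iff)
  qed
  have "splits_at (stubs D A) M \<longleftrightarrow>
      (\<forall>e\<in>M. \<forall>u v. fst ` e = {u, v} \<longrightarrow> (u \<in> A \<longleftrightarrow> v \<in> A))"
    unfolding splits_at_def using * by (rule ball_cong[OF refl])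
  then show ?thesis
    unfolding adjacency_matching[OF assms(2)] by blast
qed

lemma component_splits:
  assumes "M \<in> perfect_matchings (stubs D V)" "finite M"
    and "C \<in> connected_components V (multigraph_of_matching M)"
  shows "C \<subseteq> V" "splits_at (stubs D C) M"
proof -
  let ?E = "adjacency (multigraph_of_matching M)"
  have sym: "(v, u) \<in> ?E" if "(u, v) \<in> ?E" for u v
    using that by (auto simp: adjacency_def insert_commute)
  have inV: "u \<in> V \<and> v \<in> V" if uv: "(u, v) \<in> ?E" for u v
  proof -
    obtain e where e: "e \<in> M" "fst ` e = {u, v}"
      using uv unfolding adjacency_matching[OF assms(2)] by blast
    then have "e \<subseteq> stubs D V" using assms by (auto simp: perfect_matchings_iff)
    then have "fst ` e \<subseteq> V" by (auto simp: stubs_def)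
    then show ?thesis using e by auto
  qed
  obtain a where a: "a \<in> V" and C: "C = {v. v \<in> V \<and> (a, v) \<in> ?E\<^sup>*}"
    using assms(3) by (auto simp: connected_components_def quotient_def)
  show "C \<subseteq> V" using C by auto
  show "splits_at (stubs D C) M"
    unfolding splits_at_stubs_iff[OF assms(1,2)] C
    using inV by (auto intro: rtrancl_into_rtrancl sym)
qed

text \<open>The component of a vertex of \<open>A\<close> cannot leave the closed set
\<open>A\<close>; being closed itself, it is all of \<open>A\<close>.\<close>

lemma connected_closed_set_is_component:
  assumes "M \<in> perfect_matchings (stubs D V)" "finite M"
    and "A \<subseteq> V" "A \<noteq> {}" "splits_at (stubs D A) M" "connects D A M"
  shows "A \<in> connected_components V (multigraph_of_matching M)"
proof -
  let ?G = "multigraph_of_matching M"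
  obtain a where a: "a \<in> A" using assms(4) by blast
  define C where "C = {v. v \<in> V \<and> (a, v) \<in> (adjacency ?G)\<^sup>*}"
  have C: "C \<in> connected_components V ?G"
    unfolding connected_components_def quotient_def C_def using a assms(3) by auto
  have "v \<in> A" if "(a, v) \<in> (adjacency ?G)\<^sup>*" for v
    using that
  proof induction
    case (step y z)
    then show ?case using assms(5) unfolding splits_at_stubs_iff[OF assms(1,2)] by auto
  qed (use a in auto)
  then have "C \<subseteq> A" by (auto simp: C_def)
  moreover have "a \<in> C" using a assms(3) by (auto simp: C_def)
  ultimately have "C = A"
    using assms(6) component_splits(2)[OF assms(1,2) C] unfolding connects_def by blast
  then show ?thesis using C by simp
qed

section \<open>Counting matchings by their components\<close>

text \<open>If \<open>B\<close> is closed, so is its complement in \<open>A\<close>, and one of the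
two has at most half the vertices. The bound is the union bound over that smaller part.\<close>

lemma card_disconnected_le:
  assumes "finite A"
  shows "card {M \<in> perfect_matchings (stubs D A). \<not> connects D A M}
    \<le> (\<Sum>j = 1..card A div 2. (card A choose j) *
          (matching_number (j * D) * matching_number ((card A - j) * D)))"
proof -
  define \<B> where "\<B> = (\<lambda>j. {B. B \<subseteq> A \<and> card B = j})"
  define X where "X = (\<lambda>B. {M \<in> perfect_matchings (stubs D A). splits_at (stubs D B) M})"
  have fin: "finite (\<B> j)" for j
    using assms by (simp add: \<B>_def)
  have cover: "{M \<in> perfect_matchings (stubs D A). \<not> connects D A M}
      \<subseteq> (\<Union>j\<in>{1..card A div 2}. \<Union>B\<in>\<B> j. X B)"
  proof clarify
    fix M assume M: "M \<in> perfect_matchings (stubs D A)" and "\<not> connects D A M"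
    then obtain B where B: "B \<subseteq> A" "splits_at (stubs D B) M" "B \<noteq> {}" "B \<noteq> A"
      by (auto simp: connects_def)
    have fB: "finite B" "card B > 0" "card B < card A"
      using B assms by (auto simp: finite_subset card_gt_0_iff intro: psubset_card_mono)
    have eq: "stubs D (A - B) = stubs D A - stubs D B" by (auto simp: stubs_def)
    have "splits_at (stubs D (A - B)) M"
      unfolding splits_at_def
    proof
      fix e assume e: "e \<in> M"
      then have "e \<subseteq> stubs D A" using M by (auto simp: perfect_matchings_iff)
      moreover have "e \<subseteq> stubs D B \<or> e \<inter> stubs D B = {}"
        using B(2) e unfolding splits_at_def by blast
      ultimately show "e \<subseteq> stubs D (A - B) \<or> e \<inter> stubs D (A - B) = {}"
        unfolding eq by blast
    qed
    then have XB: "M \<in> X B" "M \<in> X (A - B)" using M B by (auto simp: X_def)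
    have cd: "card (A - B) = card A - card B" using B fB by (simp add: card_Diff_subset)
    show "M \<in> (\<Union>j\<in>{1..card A div 2}. \<Union>B\<in>\<B> j. X B)"
    proof (cases "card B \<le> card A div 2")
      case True
      then show ?thesis using XB B fB by (auto simp: \<B>_def intro!: bexI[of _ "card B"])
    next
      case False
      then have "card (A - B) \<in> {1..card A div 2}" using cd fB by auto
      then show ?thesis using XB by (auto simp: \<B>_def intro!: bexI[of _ "card (A - B)"])
    qed
  qed
  have XB: "card (X B) = matching_number (j * D) * matching_number ((card A - j) * D)"
    if "B \<in> \<B> j" for B j
    using that assms unfolding X_def \<B>_def
    by (simp add: card_splitting_matchings finite_stubs stubs_mono card_stubs diff_mult_distrib)
  have "finite (\<Union>j\<in>{1..card A div 2}. \<Union>B\<in>\<B> j. X B)"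
    using fin assms by (simp add: X_def finite_perfect_matchings finite_stubs)
  then have "card {M \<in> perfect_matchings (stubs D A). \<not> connects D A M}
      \<le> card (\<Union>j\<in>{1..card A div 2}. \<Union>B\<in>\<B> j. X B)"
    using cover by (rule card_mono)
  also have "\<dots> \<le> (\<Sum>j = 1..card A div 2. card (\<Union>B\<in>\<B> j. X B))"
    by (rule card_UN_le) simp
  also have "\<dots> \<le> (\<Sum>j = 1..card A div 2. \<Sum>B\<in>\<B> j. card (X B))"
    by (intro sum_mono card_UN_le fin)
  also have "\<dots> = (\<Sum>j = 1..card A div 2. (card A choose j) *
          (matching_number (j * D) * matching_number ((card A - j) * D)))"
    using XB assms by (intro sum.cong refl) (simp add: \<B>_def n_subsets)
  finally show ?thesis .
qed

definition matchings_with_component :: "nat \<Rightarrow> 'v set \<Rightarrow> nat \<Rightarrow> ('v \<times> nat) set set set" where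
  "matchings_with_component D V k = {M \<in> perfect_matchings (stubs D V).
     \<exists>C\<in>connected_components V (multigraph_of_matching M). card C = k}"

lemma card_matchings_with_component_le:
  assumes "finite V"
  shows "card (matchings_with_component D V k)
    \<le> (card V choose k) * (matching_number (k * D) * matching_number ((card V - k) * D))"
proof -
  define \<B> where "\<B> = {B. B \<subseteq> V \<and> card B = k}"
  define X where "X = (\<lambda>B. {M \<in> perfect_matchings (stubs D V). splits_at (stubs D B) M})"
  have fin: "finite \<B>" using assms by (simp add: \<B>_def)
  have "matchings_with_component D V k \<subseteq> (\<Union>B\<in>\<B>. X B)"
  proof
    fix M assume "M \<in> matchings_with_component D V k"
    then obtain C where M: "M \<in> perfect_matchings (stubs D V)"
      and C: "C \<in> connected_components V (multigraph_of_matching M)" "card C = k"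
      by (auto simp: matchings_with_component_def)
    have "finite M" using M assms finite_matching finite_stubs by blast
    then show "M \<in> (\<Union>B\<in>\<B>. X B)"
      using M C component_splits[OF M _ C(1)] by (auto simp: \<B>_def X_def)
  qed
  moreover have "finite (\<Union>B\<in>\<B>. X B)"
    using fin assms by (simp add: X_def finite_perfect_matchings finite_stubs)
  ultimately have "card (matchings_with_component D V k) \<le> card (\<Union>B\<in>\<B>. X B)"
    by (intro card_mono)
  also have "\<dots> \<le> (\<Sum>B\<in>\<B>. card (X B))" by (intro card_UN_le fin)
  also have "\<dots> = (\<Sum>B\<in>\<B>. matching_number (k * D) * matching_number ((card V - k) * D))"
    using assms unfolding X_def \<B>_def
    by (intro sum.cong refl)
      (auto simp: card_splitting_matchings finite_stubs stubs_mono card_stubs diff_mult_distrib)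
  also have "\<dots> = (card V choose k) * (matching_number (k * D) * matching_number ((card V - k) * D))"
    using assms by (simp add: \<B>_def n_subsets)
  finally show ?thesis .
qed

lemma card_subsets_containing:
  assumes "finite V" "a \<in> V" "0 < k"
  shows "card {A. A \<subseteq> V \<and> a \<in> A \<and> card A = k} = (card V - 1) choose (k - 1)"
proof -
  have "bij_betw (insert a) {B. B \<subseteq> V - {a} \<and> card B = k - 1}
      {A. A \<subseteq> V \<and> a \<in> A \<and> card A = k}"
    using assms
    by (intro bij_betw_byWitness[where f' = "\<lambda>A. A - {a}"])
      (auto simp: finite_subset card_insert_if)
  then show ?thesis
    using assms by (simp add: bij_betw_same_card[symmetric] n_subsets)
qed

text \<open>A sharp lower bound needs disjoint events, hence only sets \<open>A\<close> through a
fixed vertex \<open>a\<close> are used. If both \<open>A\<close> and \<open>B\<close> are closed and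
connected, then \<open>A \<inter> B\<close> is closed and contains \<open>a\<close>, so it equals
both. For each such \<open>A\<close> a matching that connects \<open>A\<close> can be completed
outside \<open>A\<close> in every possible way.\<close>

lemma card_matchings_with_component_ge:
  assumes "finite V" "0 < k" "k \<le> card V"
    and conn: "\<And>A. A \<subseteq> V \<Longrightarrow> card A = k \<Longrightarrow>
      c \<le> card {M \<in> perfect_matchings (stubs D A). connects D A M}"
  shows "((card V - 1) choose (k - 1)) * (c * matching_number ((card V - k) * D))
    \<le> card (matchings_with_component D V k)"
proof -
  obtain a where a: "a \<in> V" using assms by fastforce
  define \<A> where "\<A> = {A. A \<subseteq> V \<and> a \<in> A \<and> card A = k}"
  define X where "X = (\<lambda>A. {M \<in> perfect_matchings (stubs D V).
    splits_at (stubs D A) M \<and> connects D A M})"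
  have fX: "finite (X A)" for A
    using assms(1) by (simp add: X_def finite_perfect_matchings finite_stubs)
  have X_ge: "c * matching_number ((card V - k) * D) \<le> card (X A)" if A: "A \<in> \<A>" for A
  proof -
    have AV: "A \<subseteq> V" "card A = k" using A by (auto simp: \<A>_def)
    then have fA: "finite A" using assms(1) finite_subset by blast
    have eq: "stubs D V - stubs D A = stubs D (V - A)" by (auto simp: stubs_def)
    have bij: "bij_betw (\<lambda>(M, N). M \<union> N)
        (perfect_matchings (stubs D A) \<times> perfect_matchings (stubs D V - stubs D A))
        {M \<in> perfect_matchings (stubs D V). splits_at (stubs D A) M}"
      by (rule splitting_matchings_bij[OF stubs_mono[OF AV(1)]])
    let ?P = "{M \<in> perfect_matchings (stubs D A). connects D A M}
        \<times> perfect_matchings (stubs D V - stubs D A)"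
    have "card ?P = card ((\<lambda>(M, N). M \<union> N) ` ?P)"
      by (rule card_image[symmetric], rule inj_on_subset[OF bij_betw_imp_inj_on[OF bij]]) blast
    also have "\<dots> \<le> card (X A)"
    proof (intro card_mono fX)
      show "(\<lambda>(M, N). M \<union> N) ` ?P \<subseteq> X A"
      proof clarify
        fix M N assume M: "M \<in> perfect_matchings (stubs D A)" "connects D A M"
          and N: "N \<in> perfect_matchings (stubs D V - stubs D A)"
        have "M \<union> N \<in> {M \<in> perfect_matchings (stubs D V). splits_at (stubs D A) M}"
          using bij_betw_apply[OF bij, of "(M, N)"] M N by auto
        moreover have "connects D A (M \<union> N)" using connects_superset M(2) by blast
        ultimately show "M \<union> N \<in> X A" by (simp add: X_def)
      qed
    qed
    finally have "card ?P \<le> card (X A)" .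
    moreover have "card (perfect_matchings (stubs D V - stubs D A)) = matching_number ((card V - k) * D)"
      using AV fA assms(1) by (simp add: eq card_perfect_matchings finite_stubs card_stubs card_Diff_subset)
    ultimately show ?thesis
      using conn[OF AV] by (simp add: card_cartesian_product) (meson le_trans mult_le_mono1)
  qed
  have disj: "X A \<inter> X B = {}" if "A \<in> \<A>" "B \<in> \<A>" "A \<noteq> B" for A B
  proof (rule ccontr)
    assume "X A \<inter> X B \<noteq> {}"
    then obtain M where M: "M \<in> X A" "M \<in> X B" by blast
    then have c: "connects D A M" "connects D B M" and "splits_at (stubs D (A \<inter> B)) M"
      by (simp_all add: X_def stubs_Int splits_at_Int)
    moreover have "A \<inter> B \<noteq> {}" using that(1,2) by (auto simp: \<A>_def)
    ultimately have "A \<inter> B = A" "A \<inter> B = B"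
      unfolding connects_def by (metis Int_lower1, metis Int_lower2)
    then show False using that(3) by simp
  qed
  have "(\<Union>A\<in>\<A>. X A) \<subseteq> matchings_with_component D V k"
  proof clarify
    fix A M assume A: "A \<in> \<A>" and M: "M \<in> X A"
    then have "A \<in> connected_components V (multigraph_of_matching M)"
      using assms(1) finite_matching[of "stubs D V" M] finite_stubs[of V D]
      by (intro connected_closed_set_is_component) (auto simp: \<A>_def X_def)
    then show "M \<in> matchings_with_component D V k"
      using A M by (auto simp: matchings_with_component_def \<A>_def X_def)
  qed
  moreover have "finite (matchings_with_component D V k)"
    using assms(1) by (simp add: matchings_with_component_def finite_perfect_matchings finite_stubs)
  ultimately have "card (\<Union>A\<in>\<A>. X A) \<le> card (matchings_with_component D V k)"
    by (intro card_mono)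
  moreover have "card (\<Union>A\<in>\<A>. X A) = (\<Sum>A\<in>\<A>. card (X A))"
    using assms(1) disj fX by (intro card_UN_disjoint) (auto simp: \<A>_def)
  moreover have "(\<Sum>A\<in>\<A>. card (X A)) \<ge> (\<Sum>A\<in>\<A>. c * matching_number ((card V - k) * D))"
    by (intro sum_mono X_ge)
  moreover have "card \<A> = (card V - 1) choose (k - 1)"
    unfolding \<A>_def using card_subsets_containing[OF assms(1) a assms(2)] .
  ultimately show ?thesis by simp
qed

section \<open>The expected number of closed sets\<close>

lemma matching_number_odd: "odd m \<Longrightarrow> matching_number m = 0"
  by (induction m rule: matching_number.induct) simp_all

lemma matching_number_fact: "matching_number (2 * m) * (2 ^ m * fact m) = fact (2 * m)"
proof (induction m)
  case (Suc m)
  have two: "2 * Suc m = Suc (Suc (2 * m))" by simp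
  have "matching_number (2 * Suc m) * (2 ^ Suc m * fact (Suc m))
      = (Suc (2 * m) * matching_number (2 * m)) * ((2 * 2 ^ m) * (Suc m * fact m))"
    unfolding two by (simp only: matching_number.simps fact_Suc power_Suc of_nat_id)
  also have "\<dots> = (2 * Suc m) * (Suc (2 * m) * (matching_number (2 * m) * (2 ^ m * fact m)))"
    by (simp only: mult_ac)
  also have "\<dots> = fact (2 * Suc m)"
    unfolding Suc.IH two by (simp only: fact_Suc of_nat_id)
  finally show ?case .
qed simp

lemma matching_number_eq: "real (matching_number (2 * m)) = fact (2 * m) / (2 ^ m * fact m)"
proof -
  have "real (matching_number (2 * m) * (2 ^ m * fact m)) = real (fact (2 * m))"
    by (simp only: matching_number_fact)
  then show ?thesis by (simp add: field_simps)
qed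

text \<open>The expected number of closed vertex sets of size \<open>k\<close> in the
\<open>D\<close>-regular configuration model on \<open>n\<close> vertices.\<close>

definition expected_closed_sets :: "nat \<Rightarrow> nat \<Rightarrow> nat \<Rightarrow> real" where
  "expected_closed_sets D n k =
     real ((n choose k) * (matching_number (k * D) * matching_number ((n - k) * D)))
       / real (matching_number (n * D))"

lemma expected_closed_sets_odd: "odd (k * D) \<Longrightarrow> expected_closed_sets D n k = 0"
  unfolding expected_closed_sets_def by (simp add: matching_number_odd del: even_mult_iff)

lemma matching_ratio:
  assumes "a \<le> c"
  shows "real (matching_number (2 * a) * matching_number (2 * (c - a))) / real (matching_number (2 * c))
    = real (c choose a) / real ((2 * c) choose (2 * a))"
proof -
  have "(2::real) ^ c = 2 ^ a * 2 ^ (c - a)" using assms by (simp flip: power_add)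
  moreover have "real (c choose a) = fact c / (fact a * fact (c - a))"
    using assms by (rule binomial_fact)
  moreover have "real ((2 * c) choose (2 * a)) = fact (2 * c) / (fact (2 * a) * fact (2 * (c - a)))"
    using assms by (subst binomial_fact) (auto simp: diff_mult_distrib2)
  ultimately show ?thesis
    unfolding of_nat_mult matching_number_eq by simp
qed

lemma expected_closed_sets_even:
  assumes "k \<le> n" "n * D = 2 * N" "k * D = 2 * m"
  shows "expected_closed_sets D n k
    = real (n choose k) * (real (N choose m) / real ((2 * N) choose (2 * m)))"
proof -
  have "2 * m \<le> 2 * N" using assms mult_le_mono1 by metis
  then have "m \<le> N" by simp
  moreover have "(n - k) * D = 2 * (N - m)" using assms by (simp add: diff_mult_distrib)
  ultimately show ?thesis
    unfolding expected_closed_sets_def assms(2,3)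
    by (simp only: of_nat_mult[of "n choose k"] times_divide_eq_right[symmetric] matching_ratio)
qed

lemma binomial_mult_le: "(a choose i) * (b choose j) \<le> (a + b) choose (i + j)"
proof -
  have "(a choose i) * (b choose (i + j - i)) \<le> (\<Sum>k\<le>i + j. (a choose k) * (b choose (i + j - k)))"
    by (rule member_le_sum) auto
  then show ?thesis by (simp add: vandermonde)
qed

text \<open>With \<open>N = n + M\<close> and \<open>s = k + i\<close>, half the number of all
half-edges and of those at a set of size \<open>k\<close>, Vandermonde's inequality gives \<open>(N
choose s)^2 \<le> (2N choose 2s)\<close> as well as \<open>(n choose k) (M choose i) \<le> (N choose
s)\<close>.\<close>

lemma expected_closed_sets_le:
  assumes "k \<le> n" "2 \<le> D" "n * (D - 2) = 2 * M" "k * (D - 2) = 2 * i"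
  shows "expected_closed_sets D n k \<le> 1 / real (M choose i)"
proof -
  obtain E where E: "D = E + 2" using assms(2) by (metis add.commute le_Suc_ex)
  have N: "n * D = 2 * (n + M)" and m: "k * D = 2 * (k + i)"
    using assms E by (simp_all add: algebra_simps)
  define b where "b = real ((n + M) choose (k + i))"
  have "2 * i \<le> 2 * M" using assms mult_le_mono1 by metis
  then have iM: "i \<le> M" by simp
  have ki: "k + i \<le> n + M" using assms(1) iM by simp
  have pos: "b > 0" "real (M choose i) > 0" using ki iM by (simp_all add: b_def)
  have b1: "real (n choose k) * real (M choose i) \<le> b"
    unfolding b_def using binomial_mult_le[of n k M i] by (metis of_nat_le_iff of_nat_mult)
  have b2: "b * b \<le> real ((2 * (n + M)) choose (2 * (k + i)))"
    unfolding b_def using binomial_mult_le[of "n + M" "k + i" "n + M" "k + i"]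
    by (metis mult_2 of_nat_le_iff of_nat_mult)
  have "expected_closed_sets D n k
      = real (n choose k) * (b / real ((2 * (n + M)) choose (2 * (k + i))))"
    unfolding b_def by (rule expected_closed_sets_even[OF assms(1) N m])
  also have "\<dots> \<le> real (n choose k) * (b / (b * b))"
    using pos b2 ki by (intro mult_left_mono divide_left_mono mult_pos_pos) (auto simp del: binomial_eq_0_iff)
  also have "\<dots> \<le> 1 / real (M choose i)"
    using pos b1 by (simp add: field_simps)
  finally show ?thesis .
qed

lemma choose_two_le:
  assumes "2 \<le> i" "2 * i \<le> M"
  shows "real M * (real M - 1) / 2 \<le> real (M choose i)"
proof -
  have "real (M choose 2) \<le> real (M choose i)"
    using binomial_mono[of 2 i M] assms by simp
  moreover have "real (M choose 2) = real M * (real M - 1) / 2"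
    using assms by (simp add: choose_two real_of_nat_div algebra_simps of_nat_diff)
  ultimately show ?thesis by simp
qed

text \<open>Put \<open>M = n (D - 2) / 2\<close> and \<open>i = k (D - 2) / 2\<close>, so that
\<open>k\<close> contributes at most \<open>1 / (M choose i)\<close> if \<open>kD\<close> is even,
and nothing otherwise. The bound is \<open>1 / M\<close> for the at most one \<open>k\<close> with
\<open>i = 1\<close> and at most \<open>1 / (M choose 2)\<close> for the others, of which there are
at most \<open>M\<close>. The sum is therefore at most \<open>1 / M + 2 / (M - 1)\<close>, which is
below \<open>1/2\<close> once \<open>M \<ge> 7\<close>; since \<open>D \<ge> 3\<close>, \<open>n
\<ge> 14\<close> is enough.\<close>

lemma sum_expected_closed_sets_le_half:
  assumes "D \<ge> 3" "even (n * D)" "14 \<le> n"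
  shows "(\<Sum>k = 1..n div 2. expected_closed_sets D n k) \<le> 1 / 2"
proof -
  have D2: "even (j * (D - 2))" if "even (j * D)" for j
    using that by (cases "even j") simp_all
  obtain M where M: "n * (D - 2) = 2 * M" using D2[OF assms(2)] by (rule evenE)
  have nM: "n \<le> 2 * M"
    using assms unfolding M[symmetric] by simp
  define c where "c = 2 / (real M * (real M - 1))"
  have M7: "real M \<ge> 7" using nM assms by simp
  have c0: "c \<ge> 0" using M7 by (simp add: c_def)
  have term_le: "expected_closed_sets D n k \<le> c + (if k = 2 div (D - 2) then 1 / real M else 0)"
    if k: "k \<in> {1..n div 2}" for k
  proof (cases "even (k * D)")
    case False
    then show ?thesis using c0 by (simp add: expected_closed_sets_odd del: even_mult_iff)
  next
    case True
    then obtain i where i: "k * (D - 2) = 2 * i" using D2 by (metis evenE)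
    have le: "expected_closed_sets D n k \<le> 1 / real (M choose i)"
      using k assms by (intro expected_closed_sets_le M i) auto
    have "0 < k * (D - 2)" using k assms by simp
    then have "0 < i" using i by simp
    have "2 * k * (D - 2) \<le> n * (D - 2)" using k by (intro mult_le_mono1) auto
    then have iM: "2 * i \<le> M" using i M by (simp add: mult.assoc)
    show ?thesis
    proof (cases "i = 1")
      case True
      then have "k = 2 div (D - 2)" using i assms
        by (metis div_mult_self_is_m mult.right_neutral mult_0_right neq0_conv zero_neq_numeral)
      then show ?thesis using le True c0 by simp
    next
      case False
      then have ge: "real M * (real M - 1) / 2 \<le> real (M choose i)"
        using choose_two_le[of i M] \<open>0 < i\<close> iM by simp
      have "0 < real M * (real M - 1) / 2" using M7 by simp
      then have "1 / real (M choose i) \<le> 1 / (real M * (real M - 1) / 2)"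
        using ge by (intro frac_le) auto
      also have "\<dots> = c" by (simp add: c_def)
      finally show ?thesis using le by (smt (verit) M7 zero_le_divide_1_iff)
    qed
  qed
  have "(\<Sum>k = 1..n div 2. expected_closed_sets D n k)
      \<le> (\<Sum>k = 1..n div 2. c + (if k = 2 div (D - 2) then 1 / real M else 0))"
    by (intro sum_mono term_le)
  also have "\<dots> = real (n div 2) * c + (\<Sum>k = 1..n div 2. if k = 2 div (D - 2) then 1 / real M else 0)"
    by (simp add: sum.distrib)
  also have "\<dots> \<le> real M * c + 1 / real M"
  proof (intro add_mono mult_right_mono c0)
    show "real (n div 2) \<le> real M" using nM by simp
    show "(\<Sum>k = 1..n div 2. if k = 2 div (D - 2) then 1 / real M else 0) \<le> 1 / real M"
      by (simp add: sum.delta)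
  qed
  also have "\<dots> = 2 / (real M - 1) + 1 / real M"
    using M7 by (simp add: c_def)
  also have "\<dots> \<le> 2 / 6 + 1 / 7"
    using M7 by (intro add_mono divide_left_mono mult_pos_pos) auto
  also have "\<dots> \<le> 1 / 2" by simp
  finally show ?thesis .
qed

text \<open>The probability of being disconnected is at most the expected number of closed sets with
at most half the vertices, which is at most \<open>1/2\<close>.\<close>

lemma card_connecting_matchings_ge:
  assumes "D \<ge> 3" "even (card A * D)" "14 \<le> card A" "finite A"
  shows "real (matching_number (card A * D)) / 2
    \<le> real (card {M \<in> perfect_matchings (stubs D A). connects D A M})"
proof -
  let ?P = "perfect_matchings (stubs D A)" and ?m = "matching_number (card A * D)"
  have fin: "finite ?P" using assms by (simp add: finite_perfect_matchings finite_stubs)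
  have tot: "card ?P = ?m" using assms by (simp add: card_perfect_matchings finite_stubs card_stubs)
  obtain N where "card A * D = 2 * N" using assms(2) by (rule evenE)
  then have pos: "real ?m > 0" by (simp add: matching_number_eq)
  have "real (card {M \<in> ?P. \<not> connects D A M})
      \<le> (\<Sum>j = 1..card A div 2. real ((card A choose j) *
          (matching_number (j * D) * matching_number ((card A - j) * D))))"
    using card_disconnected_le[OF assms(4), of D] unfolding of_nat_sum[symmetric]
    by (simp only: of_nat_le_iff)
  also have "\<dots> = (\<Sum>j = 1..card A div 2. expected_closed_sets D (card A) j) * real ?m"
    using pos by (simp add: expected_closed_sets_def sum_distrib_right)
  also have "\<dots> \<le> 1 / 2 * real ?m"
    using sum_expected_closed_sets_le_half[OF assms(1-3)] pos by (intro mult_right_mono) auto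
  finally have "real (card {M \<in> ?P. \<not> connects D A M}) \<le> real ?m / 2" by simp
  moreover have "card ?P = card {M \<in> ?P. connects D A M} + card {M \<in> ?P. \<not> connects D A M}"
  proof -
    have "?P = {M \<in> ?P. connects D A M} \<union> {M \<in> ?P. \<not> connects D A M}" by blast
    moreover have "card ({M \<in> ?P. connects D A M} \<union> {M \<in> ?P. \<not> connects D A M})
        = card {M \<in> ?P. connects D A M} + card {M \<in> ?P. \<not> connects D A M}"
      using fin by (intro card_Un_disjoint) auto
    ultimately show ?thesis by simp
  qed
  ultimately show ?thesis using tot by simp
qed

section \<open>Entropy asymptotics\<close>

text \<open>Stirling's formula up to a polynomial factor, by induction. The step for the lower bound
is \<open>n log (1 + 1/n) \<le> 1\<close>, that for the upper bound, with error \<open>1 + ln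
n\<close>, is \<open>(n + 1) log (1 + 1/n) \<ge> 1\<close>. The error \<open>1 + ln (n + 1)\<close>
also covers \<open>n = 0\<close>.\<close>

lemma ln_fact_bounds: "\<bar>ln (fact n) - (real n * ln (real n) - real n)\<bar> \<le> 1 + ln (real n + 1)"
proof -
  have lower: "real n * ln (real n) - real n \<le> ln (fact n)"
  proof (induction n)
    case (Suc n)
    have "real n * (ln (real n + 1) - ln (real n)) \<le> 1"
    proof (cases "n = 0")
      case False
      then have "ln (real n + 1) - ln (real n) = ln (1 + 1 / real n)"
      proof -
        have "1 + 1 / real n = (real n + 1) / real n" using False by (simp add: field_simps)
        then show ?thesis using False by (simp add: ln_div)
      qed
      also have "\<dots> \<le> 1 / real n" by (intro ln_add_one_self_le_self) simp
      finally have "real n * (ln (real n + 1) - ln (real n)) \<le> real n * (1 / real n)"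
        by (intro mult_left_mono) auto
      then show ?thesis using False by simp
    qed simp
    moreover have "ln (fact (Suc n)) = ln (real n + 1) + ln (fact n)"
      by (simp add: ln_mult add.commute)
    ultimately show ?case using Suc.IH by (simp add: algebra_simps)
  qed simp
  have upper: "ln (fact m) \<le> real m * ln (real m) - real m + 1 + ln (real m)" if "m \<ge> 1" for m
    using that
  proof (induction m rule: dec_induct)
    case (step m)
    have "1 / (real m + 1) \<le> ln (real m + 1) - ln (real m)"
    proof -
      have "ln (real m / (real m + 1)) \<le> real m / (real m + 1) - 1"
        using step by (intro ln_le_minus_one) auto
      then show ?thesis using step by (simp add: ln_div field_simps)
    qed
    then have "(real m + 1) * (1 / (real m + 1)) \<le> (real m + 1) * (ln (real m + 1) - ln (real m))"
      by (intro mult_left_mono) auto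
    moreover have "ln (fact (Suc m)) = ln (real m + 1) + ln (fact m)"
      by (simp add: ln_mult add.commute)
    ultimately show ?case using step.IH by (simp add: algebra_simps)
  qed simp
  show ?thesis
  proof (cases "n = 0")
    case False
    then have "1 \<le> n" "0 \<le> ln (real n)" "ln (real n) \<le> ln (real n + 1)" by simp_all
    then show ?thesis using lower upper[of n] by linarith
  qed simp
qed

definition entropy :: "real \<Rightarrow> real" where
  "entropy x = - (x * ln x + (1 - x) * ln (1 - x))"

lemma entropy_ratio:
  assumes "k \<le> n" "0 < n"
  shows "real n * entropy (real k / real n)
    = real n * ln (real n) - real k * ln (real k) - real (n - k) * ln (real (n - k))"
proof -
  have frac: "real n * (real j / real n * ln (real j / real n)) = real j * (ln (real j) - ln (real n))" for j
    using assms by (cases "j = 0") (simp_all add: ln_div)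
  have "1 - real k / real n = real (n - k) / real n"
    using assms by (simp add: field_simps of_nat_diff)
  moreover have "real n * - (x + y) = - (real n * x) - real n * y" for x y
    by (simp add: algebra_simps)
  ultimately have "real n * entropy (real k / real n)
      = - (real n * (real k / real n * ln (real k / real n)))
        - real n * (real (n - k) / real n * ln (real (n - k) / real n))"
    by (simp only: entropy_def)
  also have "\<dots> = - (real k * (ln (real k) - ln (real n)))
      - real (n - k) * (ln (real (n - k)) - ln (real n))"
    unfolding frac ..
  finally show ?thesis using assms by (simp add: algebra_simps of_nat_diff)
qed

lemma ln_binomial_entropy:
  assumes "k \<le> n" "0 < n"
  shows "\<bar>ln (real (n choose k)) - real n * entropy (real k / real n)\<bar> \<le> 3 * (1 + ln (real n + 1))"
proof -
  have sum3: "\<bar>L - (a - b - c)\<bar> \<le> 3 * (1 + t)"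
    if "L = F - F' - F''" "x = y + z" "\<bar>F - (a - x)\<bar> \<le> 1 + t" "\<bar>F' - (b - y)\<bar> \<le> 1 + t'"
      "\<bar>F'' - (c - z)\<bar> \<le> 1 + t''" "t' \<le> t" "t'' \<le> t"
    for L F F' F'' a b c x y z t t' t'' :: real
    using that by (simp add: abs_le_iff)
  show ?thesis
    unfolding entropy_ratio[OF assms]
  proof (rule sum3[OF _ _ ln_fact_bounds ln_fact_bounds ln_fact_bounds])
    show "ln (real (n choose k)) = ln (fact n) - ln (fact k) - ln (fact (n - k))"
      using assms by (simp add: binomial_fact ln_div ln_mult)
  qed (use assms in simp_all)
qed

lemma continuous_on_entropy: "continuous_on {0..1} entropy"
proof -
  have *: "continuous_on {0..1} (\<lambda>x::real. x * ln x)"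
    unfolding continuous_on_eq_continuous_within
  proof
    fix x :: real assume x: "x \<in> {0..1}"
    show "continuous (at x within {0..1}) (\<lambda>x. x * ln x)"
    proof (cases "x = 0")
      case True
      have "((\<lambda>x::real. x * ln x) \<longlongrightarrow> 0) (at_right 0)" by real_asymp
      then show ?thesis using True by (simp add: continuous_within at_within_Icc_at_right)
    qed (use x in \<open>auto intro!: continuous_intros\<close>)
  qed
  have "continuous_on {0..1} (\<lambda>x::real. (1 - x) * ln (1 - x))"
    by (rule continuous_on_compose2[OF *]) (auto intro!: continuous_intros)
  then show ?thesis
    unfolding entropy_def by (intro continuous_on_minus continuous_on_add *)
qed

text \<open>The three binomial coefficients in \<open>T(n,k)\<close> have the same proportion
\<open>k/n\<close> and contribute \<open>n\<close>, \<open>nD/2\<close> and \<open>-nD\<close> times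
its entropy.\<close>

lemma ln_expected_closed_sets:
  assumes "k \<le> n" "0 < n" "0 < D" "even (n * D)" "even (k * D)"
  shows "0 < expected_closed_sets D n k"
    and "\<bar>ln (expected_closed_sets D n k) - real n * ((1 - real D / 2) * entropy (real k / real n))\<bar>
      \<le> 9 * (1 + ln (real (n * D) + 1))"
proof -
  obtain N m where N: "n * D = 2 * N" and m: "k * D = 2 * m" using assms by blast
  have "2 * m \<le> 2 * N" using assms N m mult_le_mono1 by metis
  then have mN: "m \<le> N" by simp
  have N0: "0 < N" using N assms by (cases N) auto
  have mN2: "2 * m \<le> 2 * N" and N2: "0 < 2 * N" using mN N0 by simp_all
  have rN: "real n * real D = 2 * real N" and rm: "real k * real D = 2 * real m"
    using N m by (metis of_nat_mult of_nat_numeral)+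
  have frac: "real m / real N = real k / real n"
  proof -
    have "real m / real N = (2 * real m) / (2 * real N)" by simp
    also have "\<dots> = real k / real n" unfolding rN[symmetric] rm[symmetric] using assms by simp
    finally show ?thesis .
  qed
  have frac2: "real (2 * m) / real (2 * N) = real k / real n" using frac by simp
  have eq: "expected_closed_sets D n k
      = real (n choose k) * (real (N choose m) / real ((2 * N) choose (2 * m)))"
    by (rule expected_closed_sets_even[OF assms(1) N m])
  show "0 < expected_closed_sets D n k"
    unfolding eq using assms mN by simp
  have le: "ln (real j + 1) \<le> ln (real (n * D) + 1)" if "j \<le> n * D" for j
    using that by (simp del: of_nat_mult)
  have sum3: "\<bar>L - X\<bar> \<le> 9 * (1 + t)"
    if "L = F + F' - F''" "X = a + b - c" "\<bar>F - a\<bar> \<le> 3 * (1 + u)" "\<bar>F' - b\<bar> \<le> 3 * (1 + u')"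
      "\<bar>F'' - c\<bar> \<le> 3 * (1 + u'')" "u \<le> t" "u' \<le> t" "u'' \<le> t"
    for L X F F' F'' a b c t u u' u'' :: real
    using that by (simp add: abs_le_iff)
  show "\<bar>ln (expected_closed_sets D n k) - real n * ((1 - real D / 2) * entropy (real k / real n))\<bar>
      \<le> 9 * (1 + ln (real (n * D) + 1))"
  proof (rule sum3[OF _ _ ln_binomial_entropy[OF assms(1,2)]
        ln_binomial_entropy[OF mN N0, unfolded frac]
        ln_binomial_entropy[OF mN2 N2, unfolded frac2] le le le])
    show "ln (expected_closed_sets D n k)
        = ln (real (n choose k)) + ln (real (N choose m)) - ln (real ((2 * N) choose (2 * m)))"
      unfolding eq using assms mN by (simp add: ln_mult ln_div)
    show "real n * ((1 - real D / 2) * entropy (real k / real n))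
        = real n * entropy (real k / real n) + real N * entropy (real k / real n)
          - real (2 * N) * entropy (real k / real n)"
      using rN by (simp add: algebra_simps)
    show "n \<le> n * D" using assms(3) by simp
    show "N \<le> n * D" "2 * N \<le> n * D" using N by simp_all
  qed
qed

section \<open>The probability of a component of prescribed size\<close>

lemma prob_component_size_event:
  assumes "even (n * D)"
  shows "measure_pmf.prob (configuration_model n (\<lambda>_. D)) (component_size_event n q \<epsilon>)
    = real (card {M \<in> perfect_matchings (stubs D {1..n}).
        multigraph_of_matching M \<in> component_size_event n q \<epsilon>}) / real (matching_number (n * D))"
proof -
  let ?P = "perfect_matchings (stubs D {1..n})"
  obtain N where "n * D = 2 * N" using assms by (rule evenE)
  then have "real (matching_number (n * D)) > 0" by (simp add: matching_number_eq)
  moreover have fin: "finite ?P" by (simp add: finite_perfect_matchings finite_stubs)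
  moreover have card: "card ?P = matching_number (n * D)"
    by (simp add: card_perfect_matchings finite_stubs card_stubs)
  ultimately have "?P \<noteq> {}" by fastforce
  then show ?thesis
    using fin card unfolding configuration_model_def half_edges_const
    by (simp add: measure_pmf_of_set Int_def)
qed

lemma prob_component_size_event_le:
  assumes "even (n * D)"
  shows "measure_pmf.prob (configuration_model n (\<lambda>_. D)) (component_size_event n q \<epsilon>)
    \<le> (\<Sum>k | k \<le> n \<and> real k \<in> {real n * (q - \<epsilon>)..real n * (q + \<epsilon>)}. expected_closed_sets D n k)"
proof -
  define K where "K = {k. k \<le> n \<and> real k \<in> {real n * (q - \<epsilon>)..real n * (q + \<epsilon>)}}"
  let ?W = "matchings_with_component D {1..n}"
  have fK: "finite K" by (simp add: K_def)
  have "{M \<in> perfect_matchings (stubs D {1..n}). multigraph_of_matching M \<in> component_size_event n q \<epsilon>}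
      \<subseteq> (\<Union>k\<in>K. ?W k)"
  proof clarify
    fix M assume M: "M \<in> perfect_matchings (stubs D {1..n})"
      and "multigraph_of_matching M \<in> component_size_event n q \<epsilon>"
    then obtain C where C: "C \<in> connected_components {1..n} (multigraph_of_matching M)"
      and size: "real (card C) \<in> {real n * (q - \<epsilon>)..real n * (q + \<epsilon>)}"
      by (auto simp: component_size_event_def)
    have "finite M" using M finite_matching finite_stubs by blast
    then have "C \<subseteq> {1..n}" using component_splits(1) M C by blast
    then have "card C \<le> n" using card_mono[of "{1..n}" C] by simp
    then show "M \<in> (\<Union>k\<in>K. ?W k)"
      using M C size by (auto simp: K_def matchings_with_component_def)
  qed
  moreover have "finite (\<Union>k\<in>K. ?W k)"
    using fK by (auto simp: matchings_with_component_def finite_perfect_matchings finite_stubs)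
  ultimately have "card {M \<in> perfect_matchings (stubs D {1..n}).
      multigraph_of_matching M \<in> component_size_event n q \<epsilon>} \<le> card (\<Union>k\<in>K. ?W k)"
    by (intro card_mono)
  also have "\<dots> \<le> (\<Sum>k\<in>K. card (?W k))" by (intro card_UN_le fK)
  also have "\<dots> \<le> (\<Sum>k\<in>K. (n choose k) * (matching_number (k * D) * matching_number ((n - k) * D)))"
    using card_matchings_with_component_le[of "{1..n}" D] by (intro sum_mono) simp
  finally have "real (card {M \<in> perfect_matchings (stubs D {1..n}).
        multigraph_of_matching M \<in> component_size_event n q \<epsilon>}) / real (matching_number (n * D))
      \<le> real (\<Sum>k\<in>K. (n choose k) * (matching_number (k * D) * matching_number ((n - k) * D)))
          / real (matching_number (n * D))"
    by (intro divide_right_mono) (simp_all only: of_nat_le_iff of_nat_0_le_iff)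
  also have "\<dots> = (\<Sum>k\<in>K. expected_closed_sets D n k)"
    by (simp add: expected_closed_sets_def sum_divide_distrib)
  finally show ?thesis
    unfolding prob_component_size_event[OF assms] K_def .
qed

text \<open>The factor \<open>k/n\<close> is \<open>(n-1 choose k-1) / (n choose k)\<close>, the
price for fixing a vertex of the component; the factor \<open>1/2\<close> is the bound for the
probability that the component is connected.\<close>

lemma prob_component_size_event_ge:
  assumes "D \<ge> 3" "even (n * D)" "even (k * D)" "14 \<le> k" "k \<le> n"
    and size: "real k \<in> {real n * (q - \<epsilon>)..real n * (q + \<epsilon>)}"
  shows "real k / real n * expected_closed_sets D n k / 2
    \<le> measure_pmf.prob (configuration_model n (\<lambda>_. D)) (component_size_event n q \<epsilon>)"
proof -
  let ?m = "matching_number (k * D)" and ?m' = "matching_number ((n - k) * D)"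
  \<comment> \<open>half the number of matchings, rounded up\<close>
  define c where "c = (?m + 1) div 2"
  have c: "real ?m / 2 \<le> real c" unfolding c_def by linarith
  have "c \<le> card {M \<in> perfect_matchings (stubs D A). connects D A M}"
    if A: "A \<subseteq> {1..n}" "card A = k" for A
  proof -
    have "real ?m / 2 \<le> real (card {M \<in> perfect_matchings (stubs D A). connects D A M})"
      using card_connecting_matchings_ge[OF assms(1), of A] A assms(3,4) finite_subset[OF A(1)] by simp
    then show ?thesis unfolding c_def by linarith
  qed
  then have "((card {1..n} - 1) choose (k - 1)) * (c * matching_number ((card {1..n} - k) * D))
      \<le> card (matchings_with_component D {1..n} k)"
    using assms by (intro card_matchings_with_component_ge) auto
  also have "\<dots> \<le> card {M \<in> perfect_matchings (stubs D {1..n}).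
      multigraph_of_matching M \<in> component_size_event n q \<epsilon>}"
    using size by (intro card_mono)
      (auto simp: matchings_with_component_def component_size_event_def
        finite_perfect_matchings finite_stubs)
  finally have *: "real (((n - 1) choose (k - 1)) * (c * ?m')) \<le> real (card {M \<in> perfect_matchings (stubs D {1..n}).
      multigraph_of_matching M \<in> component_size_event n q \<epsilon>})"
    by (simp only: of_nat_le_iff card_atLeastAtMost) simp
  have "k * (n choose k) = n * ((n - 1) choose (k - 1))"
    using assms by (intro times_binomial_minus1_eq) simp
  then have "real k * real (n choose k) = real n * real ((n - 1) choose (k - 1))"
    by (metis of_nat_mult)
  then have ch: "real k / real n * real (n choose k) = real ((n - 1) choose (k - 1))"
    using assms by (simp add: field_simps)
  have "real k / real n * expected_closed_sets D n k / 2
      = real ((n - 1) choose (k - 1)) * (real ?m / 2 * real ?m') / real (matching_number (n * D))"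
    unfolding ch[symmetric] expected_closed_sets_def by simp
  also have "\<dots> \<le> real ((n - 1) choose (k - 1)) * (real c * real ?m') / real (matching_number (n * D))"
    using c by (intro divide_right_mono mult_left_mono mult_right_mono) auto
  also have "\<dots> \<le> real (card {M \<in> perfect_matchings (stubs D {1..n}).
      multigraph_of_matching M \<in> component_size_event n q \<epsilon>}) / real (matching_number (n * D))"
    using * by (intro divide_right_mono) simp_all
  finally show ?thesis unfolding prob_component_size_event[OF assms(2)] .
qed

lemma log_prob_scaled_bounds:
  fixes g h :: real
  assumes "0 < n" "l \<le> ln P" "ln P \<le> u" "0 < P" "real n * g \<le> l" "u \<le> real n * h"
  shows "ereal g \<le> ereal (1 / real n) * log_prob P" "ereal (1 / real n) * log_prob P \<le> ereal h"
proof -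
  have "real n * g \<le> ln P" "ln P \<le> real n * h" using assms by simp_all
  then show "ereal g \<le> ereal (1 / real n) * log_prob P" "ereal (1 / real n) * log_prob P \<le> ereal h"
    using assms(1,4) by (simp_all add: log_prob_def field_simps)
qed

section \<open>The large deviation rate\<close>

text \<open>All subexponential factors are collected in one error term: \<open>n + 1\<close> sizes
in the union bound, Stirling's error, and the factor \<open>q/2\<close> of the lower bound. The
radius \<open>\<eta>\<close> comes from the continuity of the rate at \<open>q\<close>.\<close>

lemma component_size_rate_bounds:
  fixes q \<delta> :: real
  assumes "D \<ge> 3" "0 < q" "q \<le> 1" "0 < \<delta>"
  defines "g \<equiv> \<lambda>x. (1 - real D / 2) * entropy x"
  shows "\<forall>\<^sub>F \<epsilon> in at_right 0. \<forall>\<^sub>F n in inf sequentially (principal {n. even (n * D)}).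
    ereal (g q - \<delta>) \<le> ereal (1 / real n) * log_prob (measure_pmf.prob
        (configuration_model n (\<lambda>_. D)) (component_size_event n q \<epsilon>)) \<and>
    ereal (1 / real n) * log_prob (measure_pmf.prob
        (configuration_model n (\<lambda>_. D)) (component_size_event n q \<epsilon>)) \<le> ereal (g q + \<delta>)"
proof -
  have "continuous_on {0..1} g"
    unfolding g_def by (intro continuous_intros continuous_on_entropy)
  then obtain \<eta> where "0 < \<eta>"
    and \<eta>: "\<And>x. x \<in> {0..1} \<Longrightarrow> \<bar>x - q\<bar> < \<eta> \<Longrightarrow> \<bar>g x - g q\<bar> < \<delta> / 2"
    using assms(2-4) unfolding continuous_on_iff dist_real_def
    by (metis atLeastAtMost_iff half_gt_zero less_le_not_le)
  define err where "err = (\<lambda>n. ln (real n + 1) + 9 * (1 + ln (real (n * D) + 1)) + ln 2 - ln q)"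
  have "(\<lambda>n. err n / real n) \<longlonglongrightarrow> 0"
    using assms(1) unfolding err_def by real_asymp
  then have err_small: "\<forall>\<^sub>F n in sequentially. err n / real n < \<delta> / 2"
    using assms(4) by (intro order_tendstoD) auto
  have main: "ereal (g q - \<delta>) \<le> ereal (1 / real n) * log_prob P \<and>
      ereal (1 / real n) * log_prob P \<le> ereal (g q + \<delta>)"
    if \<epsilon>: "0 < \<epsilon>" "\<epsilon> < \<eta>" and ev: "even (n * D)" and small: "err n / real n < \<delta> / 2"
      and n: "14 / q < real n" "2 / \<epsilon> < real n"
      and P: "P = measure_pmf.prob (configuration_model n (\<lambda>_. D)) (component_size_event n q \<epsilon>)"
    for \<epsilon> n P
  proof -
    have nq: "14 < real n * q" and n\<epsilon>: "2 < real n * \<epsilon>"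
      using n \<epsilon> assms(2) by (simp_all add: field_simps)
    have n0: "0 < n" using nq by (cases n) auto
    have err: "err n < real n * (\<delta> / 2)" using small n0 by (simp add: field_simps)
    have ln0: "0 \<le> ln (real n + 1)" "0 \<le> - ln q" "0 \<le> ln (2::real)" "0 \<le> ln (real (n * D) + 1)"
      using assms(2,3) by simp_all
    \<comment> \<open>An admissible size near \<open>nq\<close>. Removing an even number of vertices from \<open>n\<close> preserves the
      parity condition on the half-edges, and \<open>q = 1\<close> gives \<open>k = n\<close>.\<close>
    define k where "k = n - 2 * nat \<lfloor>(1 - q) * real n / 2\<rfloor>"
    have x0: "0 \<le> (1 - q) * real n / 2" using assms(3) by simp
    have "real (2 * nat \<lfloor>(1 - q) * real n / 2\<rfloor>) \<le> (1 - q) * real n"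
      "(1 - q) * real n < real (2 * nat \<lfloor>(1 - q) * real n / 2\<rfloor>) + 2"
      using x0 by linarith+
    moreover have "(1 - q) * real n \<le> real n" using assms(2) n0 by (simp add: field_simps)
    ultimately have k: "real n * q \<le> real k" "real k < real n * q + 2" "k \<le> n"
      unfolding k_def by (auto simp: algebra_simps of_nat_diff)
    have k14: "14 \<le> k" using k(1) nq by linarith
    have kD: "even (k * D)"
      using ev unfolding k_def by (auto simp: diff_mult_distrib)
    have "real n * q - real n * \<epsilon> \<le> real k" "real k \<le> real n * q + real n * \<epsilon>"
      using k n\<epsilon> by linarith+
    then have size: "real k \<in> {real n * (q - \<epsilon>)..real n * (q + \<epsilon>)}"
      by (simp add: algebra_simps)
    have close: "\<bar>g (real j / real n) - g q\<bar> < \<delta> / 2"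
      if "j \<le> n" "real j \<in> {real n * (q - \<epsilon>)..real n * (q + \<epsilon>)}" for j
    proof (rule \<eta>)
      show "real j / real n \<in> {0..1}" using that n0 by simp
      have "real j / real n \<le> q + \<epsilon>" "q - \<epsilon> \<le> real j / real n"
        using that n0 by (simp_all add: field_simps)
      then show "\<bar>real j / real n - q\<bar> < \<eta>" using \<epsilon> by linarith
    qed
    note D0 = order_less_le_trans[OF zero_less_numeral assms(1)]
    have lnT: "\<bar>ln (expected_closed_sets D n j) - real n * g (real j / real n)\<bar>
        \<le> 9 * (1 + ln (real (n * D) + 1))" "0 < expected_closed_sets D n j"
      if "j \<le> n" "even (j * D)" for j
      using ln_expected_closed_sets[OF that(1) n0 D0 ev that(2)] unfolding g_def by blast+
    have Tpos: "0 < expected_closed_sets D n k" using lnT(2) k(3) kD by blast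
    have P_ge: "q * expected_closed_sets D n k / 2 \<le> P"
    proof -
      have "q \<le> real k / real n" using k(1) n0 by (simp add: field_simps)
      then have "q * expected_closed_sets D n k / 2 \<le> real k / real n * expected_closed_sets D n k / 2"
        using Tpos by (intro divide_right_mono mult_right_mono) auto
      also have "\<dots> \<le> P"
        unfolding P by (rule prob_component_size_event_ge[OF assms(1) ev kD k14 k(3) size])
      finally show ?thesis .
    qed
    have low0: "0 < q * expected_closed_sets D n k / 2" using Tpos assms(2) by simp
    have P0: "0 < P" using low0 P_ge by linarith
    have "ln q + ln (expected_closed_sets D n k) - ln 2 = ln (q * expected_closed_sets D n k / 2)"
      using Tpos assms(2) by (simp add: ln_mult ln_div)
    also have "\<dots> \<le> ln P" using low0 P_ge P0 by simp
    finally have lnP_ge: "real n * g (real k / real n) - err n \<le> ln P"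
      using lnT(1)[OF k(3) kD] ln0 unfolding err_def by linarith
    have "real n * (g q - \<delta> / 2) \<le> real n * g (real k / real n)"
    proof (rule mult_left_mono)
      show "g q - \<delta> / 2 \<le> g (real k / real n)" using close[OF k(3) size] by linarith
    qed simp
    then have lower: "real n * (g q - \<delta>) \<le> real n * g (real k / real n) - err n"
      using err by (simp add: algebra_simps)
    define b where "b = real n * (g q + \<delta> / 2) + 9 * (1 + ln (real (n * D) + 1))"
    have T_le: "expected_closed_sets D n j \<le> exp b"
      if j: "j \<le> n" "real j \<in> {real n * (q - \<epsilon>)..real n * (q + \<epsilon>)}" for j
    proof (cases "even (j * D)")
      case True
      have "real n * g (real j / real n) \<le> real n * (g q + \<delta> / 2)"
      proof (rule mult_left_mono)
        show "g (real j / real n) \<le> g q + \<delta> / 2" using close[OF j] by linarith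
      qed simp
      then have "ln (expected_closed_sets D n j) \<le> b"
        using lnT(1)[OF j(1) True] unfolding b_def by linarith
      then show ?thesis using lnT(2)[OF j(1) True] by (metis exp_le_cancel_iff exp_ln)
    qed (simp add: expected_closed_sets_odd del: even_mult_iff)
    have "P \<le> (\<Sum>j | j \<le> n \<and> real j \<in> {real n * (q - \<epsilon>)..real n * (q + \<epsilon>)}. expected_closed_sets D n j)"
      unfolding P by (rule prob_component_size_event_le[OF ev])
    also have "\<dots> \<le> (\<Sum>j | j \<le> n \<and> real j \<in> {real n * (q - \<epsilon>)..real n * (q + \<epsilon>)}. exp b)"
      using T_le by (intro sum_mono) simp
    also have "\<dots> \<le> (\<Sum>j\<le>n. exp b)"
      by (intro sum_mono2) auto
    also have "\<dots> = exp (ln (real n + 1) + b)"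
      by (simp add: exp_add add.commute)
    finally have lnP_le: "ln P \<le> ln (real n + 1) + b"
      using P0 by (metis exp_le_cancel_iff exp_ln)
    have upper: "ln (real n + 1) + b \<le> real n * (g q + \<delta>)"
    proof -
      have "real n * (g q + \<delta>) = real n * (g q + \<delta> / 2) + real n * (\<delta> / 2)"
        by (simp add: algebra_simps)
      then show ?thesis using err ln0 unfolding b_def err_def by linarith
    qed
    show ?thesis
      using log_prob_scaled_bounds[OF n0 lnP_ge lnP_le P0 lower upper] by blast
  qed
  have "\<forall>\<^sub>F n in inf sequentially (principal {n. even (n * D)}).
      ereal (g q - \<delta>) \<le> ereal (1 / real n) * log_prob (measure_pmf.prob
          (configuration_model n (\<lambda>_. D)) (component_size_event n q \<epsilon>)) \<and>
      ereal (1 / real n) * log_prob (measure_pmf.prob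
          (configuration_model n (\<lambda>_. D)) (component_size_event n q \<epsilon>)) \<le> ereal (g q + \<delta>)"
    if \<epsilon>: "0 < \<epsilon>" "\<epsilon> < \<eta>" for \<epsilon>
  proof -
    have large: "\<forall>\<^sub>F n in sequentially. c < real n" for c
      using filterlim_real_sequentially by (simp add: filterlim_at_top_dense)
    show ?thesis
      unfolding eventually_inf_principal
      using err_small large[of "14 / q"] large[of "2 / \<epsilon>"]
      by eventually_elim (use main[OF \<epsilon>] in blast)
  qed
  then show ?thesis
    unfolding eventually_at_right_field using \<open>0 < \<eta>\<close> by blast
qed

text \<open>Whichever of the two limits is taken, it lies between eventual bounds of the function.
This makes the four combinations of limits in the theorem a single case.\<close>

lemma Limsup_Liminf_between:
  fixes f :: "'a \<Rightarrow> ereal"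
  assumes "L \<in> {Limsup, Liminf}" "F \<noteq> bot" "\<forall>\<^sub>F x in F. a \<le> f x \<and> f x \<le> b"
  shows "a \<le> L F f \<and> L F f \<le> b"
proof -
  have "a \<le> Liminf F f" "Limsup F f \<le> b"
    using assms(3) by (auto intro!: Liminf_bounded Limsup_bounded elim: eventually_mono)
  moreover have "Liminf F f \<le> Limsup F f" using assms(2) by (rule Liminf_le_Limsup)
  ultimately show ?thesis using assms(1) by auto
qed

lemma even_product_filter_nontrivial: "inf sequentially (principal {n. even (n * D)}) \<noteq> bot"
proof
  assume "inf sequentially (principal {n. even (n * D)}) = bot"
  then have "\<forall>\<^sub>F n in inf sequentially (principal {n. even (n * D)}). False" by simp
  then have "\<forall>\<^sub>F n in sequentially. odd (n * D)"
    by (simp add: eventually_inf_principal del: even_mult_iff)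
  then obtain N where N: "\<forall>n\<ge>N. odd (n * D)"
    unfolding eventually_sequentially ..
  have "odd (2 * N * D)" using N[rule_format, of "2 * N"] by simp
  then show False by simp
qed

theorem corollary2p8:
  fixes D :: nat and q :: real
    and limstar_eps :: "real filter \<Rightarrow> (real \<Rightarrow> ereal) \<Rightarrow> ereal"
    and limstar_n :: "nat filter \<Rightarrow> (nat \<Rightarrow> ereal) \<Rightarrow> ereal"
  assumes "D \<ge> 3"
    and "0 < q" and "q \<le> 1"
    and "limstar_eps \<in> {Limsup, Liminf}"
    and "limstar_n \<in> {Limsup, Liminf}"
  shows "limstar_eps (at_right 0) (\<lambda>\<epsilon>.
           limstar_n (inf sequentially (principal {n. even (n * D)})) (\<lambda>n.
             ereal (1 / real n) *
             log_prob (measure_pmf.prob (configuration_model n (\<lambda>_. D))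
                         (component_size_event n q \<epsilon>))))
         = ereal (- (1 - real D / 2) * (q * ln q + (1 - q) * ln (1 - q)))"
    (is "?L = ereal ?g")
proof -
  have g: "?g = (1 - real D / 2) * entropy q"
    by (simp add: entropy_def algebra_simps)
  have bounds: "ereal (?g - \<delta>) \<le> ?L \<and> ?L \<le> ereal (?g + \<delta>)" if "0 < \<delta>" for \<delta>
    unfolding g
    by (intro Limsup_Liminf_between[OF assms(4) trivial_limit_at_right_real]
        eventually_mono[OF component_size_rate_bounds[OF assms(1-3) that]]
        Limsup_Liminf_between[OF assms(5) even_product_filter_nontrivial])
  show ?thesis
  proof (rule antisym)
    show "?L \<le> ereal ?g"
    proof (rule ereal_le_epsilon2)
      fix \<delta> :: real assume "0 < \<delta>"
      from bounds[OF this] show "?L \<le> ereal ?g + ereal \<delta>" by simp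
    qed
    show "ereal ?g \<le> ?L"
    proof (rule ereal_le_epsilon2)
      fix \<delta> :: real assume "0 < \<delta>"
      from bounds[OF this] have "ereal (?g - \<delta>) + ereal \<delta> \<le> ?L + ereal \<delta>"
        by (intro add_right_mono) blast
      then show "ereal ?g \<le> ?L + ereal \<delta>" by simp
    qed
  qed
qed

end
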